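(* Let $M>1$, $\mathcal R=[1/M,M]$, $s\in\{1,\dots,33\}$, $\hat\psi_{2s}(y)=\sum_{i=0}^{2s}\frac{y^i}{i!}$. For a positive integer $N$ let $\overline\psi_{N,2s}(x)=\big(\hat\psi_{2s}(x/2^N)\big)^{2^N}$ and $$\hat K^{sc}_{\overline\psi,N,2s}=\{\boldsymbol x\in\mathcal R^2\times\mathbb R:\ x_1/x_2\ge\overline\psi_{N,2s}(x_3/x_2)\}.$$ Then $\hat K^{sc}_{\overline\psi,N,2s}$ is second-order-cone representable, and for every $\epsilon\in(0,2M^2\log M)$ one can choose $N=O\big(\log(M^2\log(M)/s)+\log(1/\epsilon)/s\big)$ such that, when $x_3$ is restricted to $[-2M\log M,\,2M\log M]$, $$K_{\exp}(-\epsilon)\subseteq\hat K^{sc}_{\overline\psi,N,2s}\subseteq K_{\exp}(\epsilon).$$ In particular, for $s=1$, $\hat K^{sc}_{\overline\psi,N,2}$ is the set of $\boldsymbol x\in\mathcal R^2\times\mathbb R$ for which there exist $r_1,\dots,r_N\in\mathbb R$ with $$r_k\ge0\ \ \forall k\in[N-1],\quad (2r_1,x_1-x_2,x_1+x_2)\in\mathcal L_3,\quad (2r_{k+1},r_k-x_2,r_k+x_2)\in\mathcal L_3\ \ \forall k\in[N-1],\quad (x_2+2^{-N}x_3,\,r_N-x_2,\,r_N)\in\mathcal L_3 .$$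
   Context: $[n]=\{1,\dots,n\}$ (empty for $n=0$); $\mathcal L_3=\{y\in\mathbb R^3:y_3\ge\sqrt{y_1^2+y_2^2}\}$. A set is second-order-cone representable if it is a linear projection of a set defined by finitely many constraints requiring affine functions of the variables to lie in Lorentz cones. For $\alpha\in\mathbb R$, $K_{\exp}(\alpha)=\{\boldsymbol x\in\mathcal R^2\times\mathbb R:\ x_1/x_2\ge\exp(x_3/x_2-\alpha)\}$. Restricting $x_3$ to an interval means intersecting each set in the chain of inclusions with $\{\boldsymbol x: x_3\in[-2M\log M,2M\log M]\}$. $O(\cdot)$ is the usual asymptotic notation, describing growth in $M$ and $1/\epsilon$. *)

theory Defs
  imports "HOL-Analysis.Analysis" "HOL-Library.Landau_Symbols"
begin

text \<open>The Lorentz cone in dimension \<open>d\<close>, with vectors written as lists of length \<open>d\<close>.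
  For \<open>d = 1\<close> it is the nonnegative half-line, for \<open>d = 0\<close> it is empty.\<close>

definition lorentz_cone :: "nat \<Rightarrow> real list set" where
  "lorentz_cone d = {ys @ [t] | ys t. length ys + 1 = d \<and> sqrt (\<Sum>y\<leftarrow>ys. y\<^sup>2) \<le> t}"

text \<open>In the next two definitions, the pair \<open>(x, u)\<close> stands for a point of the product of
  \<open>'a\<close> with Euclidean \<open>m\<close>-space: only the coordinates \<open>u 0, \<dots>, u (m - 1)\<close> are used.\<close>

definition affine_fun :: "nat \<Rightarrow> ('a::euclidean_space \<times> (nat \<Rightarrow> real) \<Rightarrow> real) \<Rightarrow> bool" where
  "affine_fun m f \<longleftrightarrow> (\<exists>a c b. \<forall>x u. f (x, u) = a \<bullet> x + (\<Sum>j<m. c j * u j) + b)"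

definition soc_representable :: "'a::euclidean_space set \<Rightarrow> bool" where
  "soc_representable S \<longleftrightarrow>
    (\<exists>m (C :: ('a \<times> (nat \<Rightarrow> real) \<Rightarrow> real) list set).
       finite C \<and> (\<forall>fs\<in>C. \<forall>f\<in>set fs. affine_fun m f) \<and>
       S = fst ` {z. \<forall>fs\<in>C. map (\<lambda>f. f z) fs \<in> lorentz_cone (length fs)})"

definition psi_hat :: "nat \<Rightarrow> real \<Rightarrow> real" where
  "psi_hat d y = (\<Sum>i=0..d. y ^ i / fact i)"

definition psi_bar :: "nat \<Rightarrow> nat \<Rightarrow> real \<Rightarrow> real" where
  "psi_bar N d x = psi_hat d (x / 2 ^ N) ^ (2 ^ N)"

definition cone_dom :: "real \<Rightarrow> (real \<times> real \<times> real) set" where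
  "cone_dom M = {1/M..M} \<times> {1/M..M} \<times> UNIV"

definition K_exp :: "real \<Rightarrow> real \<Rightarrow> (real \<times> real \<times> real) set" where
  "K_exp M \<alpha> = {(x1, x2, x3) \<in> cone_dom M. x1 / x2 \<ge> exp (x3 / x2 - \<alpha>)}"

definition K_sc :: "real \<Rightarrow> nat \<Rightarrow> nat \<Rightarrow> (real \<times> real \<times> real) set" where
  "K_sc M N d = {(x1, x2, x3) \<in> cone_dom M. x1 / x2 \<ge> psi_bar N d (x3 / x2)}"

definition x3_slab :: "real \<Rightarrow> (real \<times> real \<times> real) set" where
  "x3_slab M = {(x1, x2, x3). x3 \<in> {- 2 * M * ln M .. 2 * M * ln M}}"

text \<open>Asymptotics in \<open>M\<close> and \<open>1/\<epsilon>\<close>: at least one of the two tends to infinity, while \<open>M\<close> stays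
  above \<open>m\<close> and \<open>\<epsilon>\<close> stays below \<open>e\<close>. For \<open>m > 1\<close> this covers \<open>\<epsilon> \<rightarrow> 0\<close> for fixed \<open>M\<close>,
  \<open>M \<rightarrow> \<infinity>\<close> for fixed \<open>\<epsilon>\<close>, and every joint limit with \<open>\<epsilon>\<close> bounded and \<open>M\<close> bounded away
  from 1.\<close>

definition growth :: "real \<Rightarrow> real \<Rightarrow> (real \<times> real) filter" where
  "growth m e = inf (filtercomap (\<lambda>(M, \<epsilon>). M + 1 / \<epsilon>) at_top)
                    (principal {(M, \<epsilon>). m \<le> M \<and> 0 < \<epsilon> \<and> \<epsilon> \<le> e})"

end

theory Submission
  imports Defs
begin

text \<open>
  Since \<open>\<integral>\<^sub>0\<^sup>\<infinity> e\<^sup>-\<^sup>u (y + u)\<^sup>n du = n! \<psi>\<^sub>n(y)\<close> for the Taylor polynomial \<open>\<psi>\<^sub>n\<close> of \<open>exp\<close>, a quadrature rule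
  for the weight \<open>e\<^sup>-\<^sup>u\<close> with nonnegative weights, exact up to degree \<open>n\<close>, writes \<open>\<psi>\<^sub>n\<close> as a nonnegative
  combination of powers \<open>(y + u)\<^sup>n\<close>. Such a rule exists because the moment vector
  \<open>(1!, \<dots>, n!)\<close> lies in the convex hull of the moment curve: otherwise a separating hyperplane
  would give a nonzero polynomial that is nonnegative on the half-line and has integral at most 0.
  For even \<open>n\<close> the epigraph of (the perspective of) each power is a projection of finitely many rotated
  Lorentz cones, and the outer power \<open>2\<^sup>N\<close> is handled in the same way.

  For \<open>h = y / 2\<^sup>N\<close> small, \<open>ln \<psi>\<^sub>2\<^sub>s(h)\<close> differs from \<open>h\<close> by at most \<open>|h|\<^sup>2\<^sup>s\<^sup>+\<^sup>1\<close>. On the slab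
  \<open>|y| \<le> B = 2M\<^sup>2 ln M\<close>, repeated squaring amplifies the error to at most
  \<open>B\<^sup>2\<^sup>s\<^sup>+\<^sup>1 / 2\<^sup>2\<^sup>s\<^sup>N\<close>, which determines \<open>N\<close>.
\<close>

section \<open>Taylor polynomials as sums of shifted powers\<close>

lemma psi_hat_0 [simp]: "psi_hat d 0 = 1"
  by (induction d) (simp_all add: psi_hat_def)

text \<open>Subtracting the top term describes the Taylor polynomial of degree \<open>d - 1\<close>
  in a form that is also correct for \<open>d = 0\<close>.\<close>

lemma has_real_derivative_psi_hat:
  "(psi_hat d has_real_derivative psi_hat d u - u ^ d / fact d) (at u)"
proof (induction d)
  case 0
  then show ?case by (simp add: psi_hat_def[abs_def])
next
  case (Suc d)
  have eq: "psi_hat (Suc d) = (\<lambda>u. psi_hat d u + u ^ Suc d / fact (Suc d))"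
    by (simp add: psi_hat_def fun_eq_iff)
  have "((\<lambda>u::real. u ^ Suc d / fact (Suc d)) has_real_derivative real (Suc d) * u ^ d / fact (Suc d)) (at u)"
    by (auto intro!: derivative_eq_intros simp del: fact_Suc power_Suc)
  also have "real (Suc d) * u ^ d / fact (Suc d) = u ^ d / fact d"
    using mult_divide_mult_cancel_left[of "real (Suc d)" "u ^ d" "fact d"] by (simp del: of_nat_Suc)
  finally show ?case
    unfolding eq using DERIV_add[OF Suc] by force
qed

lemma psi_hat_div_exp_tendsto_0: "((\<lambda>u. psi_hat d u / exp u) \<longlongrightarrow> 0) at_top"
proof -
  have "((\<lambda>u::real. \<Sum>i=0..d. (u ^ i / exp u) / fact i) \<longlongrightarrow> (\<Sum>i=0..d. 0 / fact i)) at_top"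
    by (intro tendsto_intros tendsto_power_div_exp_0) auto
  then show ?thesis
    by (simp add: psi_hat_def sum_divide_distrib mult.commute)
qed

section \<open>A quadrature rule for the weight \<open>exp (-u)\<close>\<close>

text \<open>Since \<open>u ^ j\<close> has integral \<open>fact j\<close> against the weight
  \<open>exp (-u)\<close>, the integral of \<open>p\<close> against it is 0. A nonnegative
  polynomial with integral 0 vanishes on the half-line, so it has infinitely many roots and all its
  coefficients are 0.\<close>

lemma laguerre_functional_definite:
  fixes a :: "nat \<Rightarrow> real" and n :: nat
  defines "p \<equiv> \<lambda>u. \<Sum>j=1..n. a j * (u ^ j - fact j)"
  assumes nonneg: "\<And>u. 0 \<le> u \<Longrightarrow> 0 \<le> p u"
    and j: "j \<in> {1..n}"
  shows "a j = 0"
proof -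
  \<comment> \<open>\<open>G u\<close> is the tail integral \<open>\<integral>\<^sub>u\<^sup>\<infinity> e\<^sup>-\<^sup>x p(x) dx\<close> in closed form; it decreases from 0 to 0.\<close>
  define G where "G u = (\<Sum>j=1..n. a j * fact j * (psi_hat j u - 1)) / exp u" for u :: real
  have G': "(G has_real_derivative - p u / exp u) (at u)" for u
  proof -
    have "(G has_real_derivative
        ((\<Sum>j=1..n. a j * fact j * (psi_hat j u - u ^ j / fact j)) * exp u
          - (\<Sum>j=1..n. a j * fact j * (psi_hat j u - 1)) * exp u) / (exp u * exp u)) (at u)"
      unfolding G_def[abs_def]
      by (rule DERIV_divide)
        (auto intro!: derivative_eq_intros has_real_derivative_psi_hat sum.cong simp: mult_ac)
    also have "((\<Sum>j=1..n. a j * fact j * (psi_hat j u - u ^ j / fact j)) * exp u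
          - (\<Sum>j=1..n. a j * fact j * (psi_hat j u - 1)) * exp u) / (exp u * exp u)
        = ((\<Sum>j=1..n. a j * fact j * (psi_hat j u - u ^ j / fact j))
          - (\<Sum>j=1..n. a j * fact j * (psi_hat j u - 1))) / exp u"
      by (simp add: left_diff_distrib[symmetric])
    also have "(\<Sum>j=1..n. a j * fact j * (psi_hat j u - u ^ j / fact j))
          - (\<Sum>j=1..n. a j * fact j * (psi_hat j u - 1)) = - p u"
      unfolding p_def sum_subtractf[symmetric] sum_negf[symmetric]
      by (intro sum.cong refl) (simp add: field_simps)
    finally show ?thesis .
  qed
  have anti: "G v \<le> G u" if "0 \<le> u" "u \<le> v" for u v
    using that(2)
  proof (rule DERIV_nonpos_imp_nonincreasing)
    fix x assume "u \<le> x" "x \<le> v"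
    then show "\<exists>y. (G has_real_derivative y) (at x) \<and> y \<le> 0"
      using G'[of x] nonneg[of x] that by (intro exI[of _ "- p x / exp x"]) auto
  qed
  \<comment> \<open>The constant 1 in \<open>G\<close> is \<open>psi_hat 0 u\<close>, so both
    quotients tend to 0 by the same limit.\<close>
  have "((\<lambda>u. \<Sum>j=1..n. a j * fact j * (psi_hat j u / exp u - psi_hat 0 u / exp u))
      \<longlongrightarrow> (\<Sum>j=1..n. a j * fact j * (0 - 0))) at_top"
    by (intro tendsto_intros psi_hat_div_exp_tendsto_0)
  then have lim: "(G \<longlongrightarrow> 0) at_top"
    by (simp add: G_def[abs_def] sum_divide_distrib psi_hat_def[of 0] flip: diff_divide_distrib)
  have G0: "G u = 0" if "0 \<le> u" for u
  proof (rule antisym)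
    show "G u \<le> 0" using anti[of 0 u] that by (simp add: G_def)
    show "0 \<le> G u"
      by (rule tendsto_upperbound[OF lim])
        (auto simp: eventually_at_top_linorder intro!: exI[of _ u] anti that)
  qed
  have p0: "p u = 0" if "0 < u" for u
  proof -
    \<comment> \<open>For \<open>u > 0\<close> the function \<open>G\<close> vanishes on the whole
      neighbourhood \<open>{0<..}\<close> of \<open>u\<close>.\<close>
    have "(G has_real_derivative 0) (at u)"
      by (rule DERIV_cong_ev[THEN iffD2, OF refl _ refl, of _ "\<lambda>_. 0"])
        (use that G0 in \<open>auto simp: eventually_nhds intro!: exI[of _ "{0<..}"]\<close>)
    with G'[of u] have "- p u / exp u = 0" by (rule DERIV_unique)
    then show ?thesis by simp
  qed
  \<comment> \<open>Coefficients of \<open>p\<close> as an ordinary polynomial: the terms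
    \<open>- a j * fact j\<close> all go into degree 0, and degrees \<open>1..n\<close> keep
    \<open>a\<close>.\<close>
  define c where "c k = (if k = 0 then - (\<Sum>j=1..n. a j * fact j) else a k)" for k
  have pc: "(\<Sum>k\<le>n. c k * u ^ k) = p u" for u
  proof -
    have "(\<Sum>k\<le>n. c k * u ^ k) = c 0 + (\<Sum>k=1..n. c k * u ^ k)"
      by (simp add: atMost_atLeast0 sum.atLeast_Suc_atMost)
    also have "(\<Sum>k=1..n. c k * u ^ k) = (\<Sum>k=1..n. a k * u ^ k)"
      by (intro sum.cong) (auto simp: c_def)
    finally show ?thesis
      by (simp add: p_def c_def right_diff_distrib sum_subtractf)
  qed
  have "infinite {u::real. (\<Sum>k\<le>n. c k * u ^ k) = 0}"
    by (rule infinite_super[of "{0<..}"]) (auto simp: pc p0 infinite_Ioi)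
  then have "c j = 0"
    using polyfun_finite_roots[of c n] j by auto
  then show ?thesis using j by (auto simp: c_def)
qed

text \<open>The nodes come from a convex combination of points on the moment curve. The curve
  carries only the degrees \<open>1..CARD('n)\<close>: degree 0 is the condition that convex weights
  sum to 1, which is \<open>fact 0\<close>.\<close>

lemma laguerre_quadrature_exists:
  "\<exists>S w. finite S \<and> (\<forall>u\<in>S. 0 \<le> w u) \<and>
    (\<forall>j\<le>CARD('n::finite). (\<Sum>u\<in>S. w u * u ^ j) = (fact j :: real))"
proof -
  obtain idx :: "'n \<Rightarrow> nat" where idx: "bij_betw idx UNIV {1..CARD('n)}"
    using finite_same_card_bij[of "UNIV :: 'n set" "{1..CARD('n)}"] by auto
  define \<gamma> :: "real \<Rightarrow> real ^ 'n" where "\<gamma> u = (\<chi> i. u ^ idx i)" for u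
  define \<mu> :: "real ^ 'n" where "\<mu> = (\<chi> i. fact (idx i))"
  have "\<mu> \<in> convex hull (\<gamma> ` {0..})"
  proof (rule ccontr)
    assume "\<mu> \<notin> convex hull (\<gamma> ` {0..})"
    \<comment> \<open>The hull is not known to be closed, so the separation is weak. This is enough,
      because \<open>laguerre_functional_definite\<close> draws \<open>a = 0\<close> from a weak
      inequality.\<close>
    then obtain a b where a: "a \<noteq> 0" "a \<bullet> \<mu> \<le> b"
        and b: "\<And>x. x \<in> convex hull (\<gamma> ` {0..}) \<Longrightarrow> b \<le> a \<bullet> x"
      using separating_hyperplane_sets[of "{\<mu>}" "convex hull (\<gamma> ` {0..})"] by auto
    define c where "c j = a $ (inv_into UNIV idx j)" for j
    have c: "c (idx i) = a $ i" for i
      using idx by (simp add: c_def bij_betw_def inv_into_f_f)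
    have "c j = 0" if "j \<in> {1..CARD('n)}" for j
    proof (rule laguerre_functional_definite[OF _ that])
      fix u :: real assume "0 \<le> u"
      then have "a \<bullet> \<mu> \<le> a \<bullet> \<gamma> u"
        using b[of "\<gamma> u"] a hull_subset[of "\<gamma> ` {0..}" convex] by force
      also have "a \<bullet> \<gamma> u - a \<bullet> \<mu> = (\<Sum>i\<in>UNIV. c (idx i) * (u ^ idx i - fact (idx i)))"
        by (simp add: inner_vec_def \<gamma>_def \<mu>_def c right_diff_distrib sum_subtractf)
      also have "\<dots> = (\<Sum>j=1..CARD('n). c j * (u ^ j - fact j))"
        by (rule sum.reindex_bij_betw[OF idx])
      finally show "0 \<le> (\<Sum>j=1..CARD('n). c j * (u ^ j - fact j))" by simp
    qed
    then have "a $ i = 0" for i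
      using c[of i] bij_betwE[OF idx] by (metis UNIV_I)
    with a(1) show False by (simp add: vec_eq_iff)
  qed
  then obtain T v where T: "finite T" "T \<subseteq> \<gamma> ` {0..}" "\<forall>x\<in>T. 0 \<le> v x"
      "sum v T = 1" "(\<Sum>x\<in>T. v x *\<^sub>R x) = \<mu>"
    unfolding convex_hull_explicit by blast
  \<comment> \<open>One preimage is kept for each point of \<open>T\<close>, so that the weights
    \<open>v\<close> can be reindexed by the nodes.\<close>
  then obtain S where S: "S \<subseteq> {0..}" "inj_on \<gamma> S" "\<gamma> ` S = T"
    using subset_image_inj[of T \<gamma> "{0..}"] by auto
  show ?thesis
  proof (intro exI[of _ S] exI[of _ "v \<circ> \<gamma>"] conjI allI impI)
    show "finite S" using finite_image_iff[OF S(2)] S(3) T(1) by simp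
    show "\<forall>u\<in>S. 0 \<le> (v \<circ> \<gamma>) u" using S T by auto
    have sumS: "(\<Sum>x\<in>T. f x) = (\<Sum>u\<in>S. f (\<gamma> u))" for f :: "real ^ 'n \<Rightarrow> real"
      unfolding S(3)[symmetric] by (simp add: sum.reindex[OF S(2)])
    fix j assume "j \<le> CARD('n)"
    show "(\<Sum>u\<in>S. (v \<circ> \<gamma>) u * u ^ j) = (fact j :: real)"
    proof (cases "j = 0")
      case True
      then show ?thesis using T(4) by (simp add: sumS)
    next
      case False
      then obtain i where i: "idx i = j"
        using \<open>j \<le> _\<close> bij_betw_imp_surj_on[OF idx]
        by (metis One_nat_def Suc_leI atLeastAtMost_iff imageE not_gr_zero)
      have "(\<Sum>x\<in>T. v x * x $ i) = fact j"
        using arg_cong[OF T(5), of "\<lambda>x. x $ i"] by (simp add: \<mu>_def i)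
      then show ?thesis by (simp add: sumS \<gamma>_def i)
    qed
  qed
qed

text \<open>The number of moments is the cardinality of a type, so it is fixed at \<open>66 = 2 \<cdot> 33\<close> here.\<close>

lemma psi_hat_eq_sum_shifted_powers:
  assumes "n \<le> 66"
  obtains S :: "real set" and w where "finite S" "\<And>u. u \<in> S \<Longrightarrow> 0 \<le> w u"
    "\<And>y. psi_hat n y = (\<Sum>u\<in>S. w u * (y + u) ^ n)"
proof -
  obtain S w where S: "finite S" "\<And>u. u \<in> S \<Longrightarrow> 0 \<le> w u"
      and w: "\<And>j. j \<le> 66 \<Longrightarrow> (\<Sum>u\<in>S. w u * u ^ j) = (fact j :: real)"
    using laguerre_quadrature_exists[where 'n = 66] by auto
  have "psi_hat n y = (\<Sum>u\<in>S. w u / fact n * (y + u) ^ n)" for y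
  proof -
    have "(\<Sum>u\<in>S. w u / fact n * (y + u) ^ n)
        = (\<Sum>u\<in>S. \<Sum>i\<le>n. real (n choose i) * y ^ i / fact n * (w u * u ^ (n - i)))"
      by (simp add: binomial_ring sum_distrib_left mult_ac)
    also have "\<dots> = (\<Sum>i\<le>n. real (n choose i) * y ^ i / fact n * (\<Sum>u\<in>S. w u * u ^ (n - i)))"
      by (subst sum.swap) (simp add: sum_distrib_left)
    \<comment> \<open>The moment of degree \<open>n - i\<close> is \<open>fact (n - i)\<close>, and
      \<open>(n choose i) * fact (n - i) / fact n = 1 / fact i\<close>.\<close>
    also have "\<dots> = (\<Sum>i\<le>n. y ^ i / fact i)"
      using assms by (intro sum.cong refl) (simp add: w binomial_fact field_simps)
    finally show ?thesis by (simp add: psi_hat_def atMost_atLeast0)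
  qed
  with S show ?thesis by (intro that[of S "\<lambda>u. w u / fact n"]) auto
qed

section \<open>Second-order-cone representability\<close>

lemma affine_fun_comp_affine:
  fixes L :: "'a::euclidean_space \<Rightarrow> 'b::euclidean_space"
  assumes "linear L" "affine_fun m f"
  shows "affine_fun m (\<lambda>(x, u). f (L x + d, u))"
proof -
  obtain a c b where f: "\<And>x u. f (x, u) = a \<bullet> x + (\<Sum>j<m. c j * u j) + b"
    using assms(2) unfolding affine_fun_def by blast
  have "f (L x + d, u) = adjoint L a \<bullet> x + (\<Sum>j<m. c j * u j) + (a \<bullet> d + b)" for x u
    using adjoint_works[OF assms(1), of x a]
    by (simp add: f inner_add_right inner_commute)
  then show ?thesis unfolding affine_fun_def by auto
qed

text \<open>Moves the auxiliary variables past the first \<open>k\<close>, so that two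
  representations can use disjoint blocks of them.\<close>

lemma affine_fun_shift:
  assumes "affine_fun m f"
  shows "affine_fun (k + m) (\<lambda>(x, u). f (x, \<lambda>j. u (k + j)))"
proof -
  obtain a c b where f: "\<And>x u. f (x, u) = a \<bullet> x + (\<Sum>j<m. c j * u j) + b"
    using assms unfolding affine_fun_def by blast
  define c' where "c' j = (if j < k then 0 else c (j - k))" for j
  have "(\<Sum>j<k + m. c' j * u j) = (\<Sum>j<m. c j * u (k + j))" for u :: "nat \<Rightarrow> real"
  proof -
    have "(\<Sum>j<k + m. c' j * u j) = (\<Sum>j<k. c' j * u j) + (\<Sum>j=k..<k + m. c' j * u j)"
      by (simp add: lessThan_atLeast0 sum.atLeastLessThan_concat)
    also have "(\<Sum>j=k..<k + m. c' j * u j) = (\<Sum>j<m. c j * u (k + j))"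
      using sum.shift_bounds_nat_ivl[of "\<lambda>j. c' j * u j" 0 k m]
      by (simp add: c'_def lessThan_atLeast0 add.commute)
    finally show ?thesis by (simp add: c'_def)
  qed
  then have "f (x, \<lambda>j. u (k + j)) = a \<bullet> x + (\<Sum>j<k + m. c' j * u j) + b" for x u
    by (simp add: f)
  then show ?thesis unfolding affine_fun_def by auto
qed

lemma affine_fun_cong:
  assumes "affine_fun m f" "\<And>j. j < m \<Longrightarrow> u j = v j"
  shows "f (x, u) = f (x, v)"
proof -
  obtain a c b where f: "\<And>x u. f (x, u) = a \<bullet> x + (\<Sum>j<m. c j * u j) + b"
    using assms(1) unfolding affine_fun_def by blast
  have "(\<Sum>j<m. c j * u j) = (\<Sum>j<m. c j * v j)"
    by (intro sum.cong) (auto simp: assms(2))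
  then show ?thesis by (simp add: f)
qed

lemma affine_fun_mono:
  assumes "affine_fun m f" "m \<le> n"
  shows "affine_fun n f"
proof -
  obtain a c b where f: "\<And>x u. f (x, u) = a \<bullet> x + (\<Sum>j<m. c j * u j) + b"
    using assms unfolding affine_fun_def by blast
  define c' where "c' j = (if j < m then c j else 0)" for j
  have "(\<Sum>j<n. c' j * u j) = (\<Sum>j<m. c j * u j)" for u :: "nat \<Rightarrow> real"
    by (rule sum.mono_neutral_cong_right) (use assms in \<open>auto simp: c'_def\<close>)
  then have "f (x, u) = a \<bullet> x + (\<Sum>j<n. c' j * u j) + b" for x u
    by (simp add: f)
  then show ?thesis unfolding affine_fun_def by auto
qed

lemma soc_representable_iff:
  "soc_representable S \<longleftrightarrow>
    (\<exists>m C. finite C \<and> (\<forall>fs\<in>C. \<forall>f\<in>set fs. affine_fun m f) \<and>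
       (\<forall>x. x \<in> S \<longleftrightarrow> (\<exists>u. \<forall>fs\<in>C. map (\<lambda>f. f (x, u)) fs \<in> lorentz_cone (length fs))))"
  unfolding soc_representable_def
  by (simp add: set_eq_iff image_iff Bex_def)

lemma soc_representable_vimage:
  fixes L :: "'a::euclidean_space \<Rightarrow> 'b::euclidean_space"
  assumes "linear L" "soc_representable S"
  shows "soc_representable {x. L x + d \<in> S}"
proof -
  obtain m C where C: "finite C" "\<forall>fs\<in>C. \<forall>f\<in>set fs. affine_fun m f"
      and S: "\<And>x. x \<in> S \<longleftrightarrow> (\<exists>u. \<forall>fs\<in>C. map (\<lambda>f. f (x, u)) fs \<in> lorentz_cone (length fs))"
    using assms(2) unfolding soc_representable_iff by blast
  define h where "h f = (\<lambda>(x, u). f (L x + d, u))" for f :: "'b \<times> (nat \<Rightarrow> real) \<Rightarrow> real"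
  show ?thesis
    unfolding soc_representable_iff
  proof (intro exI[of _ m] exI[of _ "map h ` C"] conjI allI)
    show "\<forall>fs\<in>map h ` C. \<forall>f\<in>set fs. affine_fun m f"
      using C(2) by (auto simp: h_def intro!: affine_fun_comp_affine[OF assms(1)])
  qed (use C in \<open>auto simp: S h_def o_def\<close>)
qed

lemma soc_representable_Int:
  fixes S T :: "'a::euclidean_space set"
  assumes "soc_representable S" "soc_representable T"
  shows "soc_representable (S \<inter> T)"
proof -
  obtain m C where C: "finite C" "\<forall>fs\<in>C. \<forall>f\<in>set fs. affine_fun m f"
      and S: "\<And>x. x \<in> S \<longleftrightarrow> (\<exists>u. \<forall>fs\<in>C. map (\<lambda>f. f (x, u)) fs \<in> lorentz_cone (length fs))"
    using assms(1) unfolding soc_representable_iff by blast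
  obtain n D where D: "finite D" "\<forall>fs\<in>D. \<forall>f\<in>set fs. affine_fun n f"
      and T: "\<And>x. x \<in> T \<longleftrightarrow> (\<exists>u. \<forall>fs\<in>D. map (\<lambda>f. f (x, u)) fs \<in> lorentz_cone (length fs))"
    using assms(2) unfolding soc_representable_iff by blast
  define h where "h f = (\<lambda>(x, u). f (x, \<lambda>j. u (m + j)))" for f :: "'a \<times> (nat \<Rightarrow> real) \<Rightarrow> real"
  have "x \<in> S \<inter> T \<longleftrightarrow>
    (\<exists>u. \<forall>fs\<in>C \<union> map h ` D. map (\<lambda>f. f (x, u)) fs \<in> lorentz_cone (length fs))" for x
  proof
    assume "x \<in> S \<inter> T"
    then obtain u v where u: "\<forall>fs\<in>C. map (\<lambda>f. f (x, u)) fs \<in> lorentz_cone (length fs)"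
        and v: "\<forall>fs\<in>D. map (\<lambda>f. f (x, v)) fs \<in> lorentz_cone (length fs)"
      unfolding S T Int_iff by blast
    \<comment> \<open>Splices the two witnesses: the first \<open>m\<close> auxiliary variables
      serve \<open>C\<close>, the following ones serve \<open>D\<close>.\<close>
    define t where "t j = (if j < m then u j else v (j - m))" for j
    have eq: "map (\<lambda>f. f (x, t)) fs = map (\<lambda>f. f (x, u)) fs" if "fs \<in> C" for fs
      using C(2) that by (auto simp: t_def intro!: affine_fun_cong[of m])
    have "\<forall>fs\<in>C. map (\<lambda>f. f (x, t)) fs \<in> lorentz_cone (length fs)"
      by (intro ballI) (subst eq, use u in auto)
    moreover have "(\<lambda>j. t (m + j)) = v"
      by (simp add: t_def)
    ultimately show "\<exists>u. \<forall>fs\<in>C \<union> map h ` D. map (\<lambda>f. f (x, u)) fs \<in> lorentz_cone (length fs)"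
      using v by (intro exI[of _ t]) (auto simp: h_def o_def)
  next
    assume "\<exists>u. \<forall>fs\<in>C \<union> map h ` D. map (\<lambda>f. f (x, u)) fs \<in> lorentz_cone (length fs)"
    then show "x \<in> S \<inter> T"
      unfolding S T Int_iff by (auto simp: h_def o_def ball_Un)
  qed
  moreover have "\<forall>fs\<in>C \<union> map h ` D. \<forall>f\<in>set fs. affine_fun (m + n) f"
    using C(2) D(2) affine_fun_mono[where 'a = 'a, of m _ "m + n"] by (auto simp: h_def intro!: affine_fun_shift)
  moreover have "finite (C \<union> map h ` D)" using C(1) D(1) by simp
  ultimately show ?thesis
    unfolding soc_representable_iff by blast
qed

text \<open>The projected coordinate \<open>t\<close> becomes the auxiliary variable with index
  \<open>m\<close>, the first one that the given constraints leave free.\<close>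

lemma soc_representable_project:
  fixes S :: "('a::euclidean_space \<times> real) set"
  assumes "soc_representable S"
  shows "soc_representable {x. \<exists>t. (x, t) \<in> S}"
proof -
  obtain m C where C: "finite C" "\<forall>fs\<in>C. \<forall>f\<in>set fs. affine_fun m f"
      and S: "\<And>x. x \<in> S \<longleftrightarrow> (\<exists>u. \<forall>fs\<in>C. map (\<lambda>f. f (x, u)) fs \<in> lorentz_cone (length fs))"
    using assms unfolding soc_representable_iff by blast
  define h where "h f = (\<lambda>(x, u). f ((x, u m), u))" for f :: "('a \<times> real) \<times> (nat \<Rightarrow> real) \<Rightarrow> real"
  have aff: "affine_fun (Suc m) (h f)" if "affine_fun m f" for f
  proof -
    obtain a c b where f: "\<And>x u. f (x, u) = a \<bullet> x + (\<Sum>j<m. c j * u j) + b"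
      using \<open>affine_fun m f\<close> unfolding affine_fun_def by blast
    have "h f (x, u) = fst a \<bullet> x + (\<Sum>j<Suc m. (c(m := snd a)) j * u j) + b" for x u
      by (simp add: h_def f inner_prod_def)
    then show ?thesis unfolding affine_fun_def by blast
  qed
  have "(\<exists>t. (x, t) \<in> S) \<longleftrightarrow>
    (\<exists>u. \<forall>fs\<in>map h ` C. map (\<lambda>f. f (x, u)) fs \<in> lorentz_cone (length fs))" for x
  proof
    assume "\<exists>t. (x, t) \<in> S"
    then obtain t u where u: "\<forall>fs\<in>C. map (\<lambda>f. f ((x, t), u)) fs \<in> lorentz_cone (length fs)"
      unfolding S by blast
    have eq: "map (\<lambda>f. f ((x, t), u(m := t))) fs = map (\<lambda>f. f ((x, t), u)) fs" if "fs \<in> C" for fs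
      using C(2) that by (auto intro!: affine_fun_cong[of m])
    have "\<forall>fs\<in>C. map (\<lambda>f. f ((x, t), u(m := t))) fs \<in> lorentz_cone (length fs)"
      by (intro ballI) (subst eq, use u in auto)
    then show "\<exists>u. \<forall>fs\<in>map h ` C. map (\<lambda>f. f (x, u)) fs \<in> lorentz_cone (length fs)"
      by (intro exI[of _ "u(m := t)"]) (auto simp: h_def o_def)
  next
    assume "\<exists>u. \<forall>fs\<in>map h ` C. map (\<lambda>f. f (x, u)) fs \<in> lorentz_cone (length fs)"
    then show "\<exists>t. (x, t) \<in> S"
      unfolding S by (auto simp: h_def o_def)
  qed
  moreover have "\<forall>fs\<in>map h ` C. \<forall>f\<in>set fs. affine_fun (Suc m) f"
    using C(2) aff by auto
  moreover have "finite (map h ` C)" using C(1) by simp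
  ultimately show ?thesis
    unfolding soc_representable_iff mem_Collect_eq by blast
qed

section \<open>Half-spaces and rotated cones from Lorentz cones of dimension one and three\<close>

lemma lorentz_cone_1_iff: "[t] \<in> lorentz_cone 1 \<longleftrightarrow> 0 \<le> t"
  by (auto simp: lorentz_cone_def)

lemma lorentz_cone_3_iff: "[a, b, t] \<in> lorentz_cone 3 \<longleftrightarrow> sqrt (a\<^sup>2 + b\<^sup>2) \<le> t"
proof -
  have "[a, b, t] = ys @ [t'] \<longleftrightarrow> ys = [a, b] \<and> t' = t" for ys t'
    using append1_eq_conv[of "[a, b]" t ys t'] by auto
  then show ?thesis by (auto simp: lorentz_cone_def)
qed

lemma lorentz_cone_3_iff': "[a, b, t] \<in> lorentz_cone 3 \<longleftrightarrow> 0 \<le> t \<and> a\<^sup>2 + b\<^sup>2 \<le> t\<^sup>2"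
  unfolding lorentz_cone_3_iff
  by (auto intro: real_le_lsqrt dest: sqrt_le_D order_trans[OF real_sqrt_ge_zero, rotated])

text \<open>By \<open>(b + c)^2 - (b - c)^2 = 4 * b * c\<close>. Both signs follow because
  \<open>b\<close> and \<open>c\<close> have a nonnegative product and a nonnegative sum.\<close>

lemma rotated_lorentz_cone_iff:
  "[2 * a, b - c, b + c] \<in> lorentz_cone 3 \<longleftrightarrow> 0 \<le> b \<and> 0 \<le> c \<and> a\<^sup>2 \<le> b * c"
proof -
  have "(2 * a)\<^sup>2 + (b - c)\<^sup>2 \<le> (b + c)\<^sup>2 \<longleftrightarrow> a\<^sup>2 \<le> b * c"
    by (simp add: power2_eq_square algebra_simps)
  moreover have "0 \<le> b \<and> 0 \<le> c" if "a\<^sup>2 \<le> b * c" "0 \<le> b + c"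
  proof -
    have "0 \<le> b * c" using that(1) zero_le_power2 order_trans by blast
    then show ?thesis using that(2) by (auto simp: zero_le_mult_iff)
  qed
  ultimately show ?thesis unfolding lorentz_cone_3_iff' by auto
qed

lemma affine_fun_linear:
  fixes g :: "'a::euclidean_space \<Rightarrow> real"
  assumes "linear g"
  shows "affine_fun 0 (\<lambda>(x, u). g x + b)"
  unfolding affine_fun_def
  \<comment> \<open>\<open>adjoint g 1\<close> is the vector that represents the functional
    \<open>g\<close> by the inner product.\<close>
  by (intro exI[of _ "adjoint g 1"] exI[of _ b] exI) (simp add: adjoint_works[OF assms] inner_commute)

lemma soc_representable_halfspace:
  fixes g :: "'a::euclidean_space \<Rightarrow> real"
  assumes "linear g"
  shows "soc_representable {x. 0 \<le> g x + b}"
  unfolding soc_representable_iff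
  by (intro exI[of _ 0] exI[of _ "{[\<lambda>(x, u). g x + b]}"])
    (auto simp: affine_fun_linear[OF assms] lorentz_cone_1_iff[unfolded One_nat_def])

lemma soc_representable_rotated_cone:
  fixes a b c :: "'a::euclidean_space \<Rightarrow> real"
  assumes "linear a" "linear b" "linear c"
  shows "soc_representable {x. 0 \<le> b x \<and> 0 \<le> c x \<and> (a x)\<^sup>2 \<le> b x * c x}"
proof -
  have l: "linear (\<lambda>x. 2 * a x)" "linear (\<lambda>x. b x - c x)" "linear (\<lambda>x. b x + c x)"
    using linear_compose_scale_right[OF assms(1), of 2] linear_compose_sub[OF assms(2,3)]
      linear_compose_add[OF assms(2,3)] by auto
  show ?thesis
    unfolding soc_representable_iff
    by (intro exI[of _ 0] exI[of _ "{[\<lambda>(x, u). 2 * a x + 0, \<lambda>(x, u). (b x - c x) + 0, \<lambda>(x, u). (b x + c x) + 0]}"])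
      (use l[THEN affine_fun_linear, of 0] in \<open>auto simp: rotated_lorentz_cone_iff[unfolded numeral_3_eq_3]\<close>)
qed

section \<open>Epigraphs of perspectives of powers, and the set \<open>K_sc\<close>\<close>

text \<open>\<open>x * (b / x) ^ n\<close> is the perspective of the power \<open>b ^ n\<close>.
  Strong induction roughly halves the exponent at the cost of one rotated cone and one auxiliary
  variable. The bound \<open>c \<le> x\<close> with \<open>c > 0\<close> keeps the divisor positive
  by a linear constraint.\<close>

lemma soc_representable_nonneg_pow:
  assumes "0 < (c::real)" "1 \<le> n"
  shows "soc_representable {(b, x, z). c \<le> x \<and> 0 \<le> b \<and> x * (b / x) ^ n \<le> z}"
  using assms(2)
proof (induction n rule: less_induct)
  case (less n)
  let ?P = "\<lambda>n. {(b, x, z). c \<le> x \<and> 0 \<le> b \<and> x * (b / x) ^ n \<le> z}"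
  have lin: "linear (\<lambda>y :: (real \<times> real \<times> real) \<times> real. (fst (fst y), fst (snd (fst y)), snd y))"
    by (intro linearI) auto
  \<comment> \<open>With \<open>x = 1\<close>: \<open>b\<^sup>2\<^sup>k \<le> z\<close> iff \<open>b\<^sup>k \<le> w\<close> and \<open>w\<^sup>2 \<le> z\<close> for some \<open>w\<close>, and
    \<open>b\<^sup>2\<^sup>k\<^sup>-\<^sup>1 \<le> z\<close> iff \<open>b\<^sup>k \<le> w\<close> and \<open>w\<^sup>2 \<le> b z\<close> for some \<open>w\<close>.\<close>
  consider "n = 1" | k where "n = 2 * k" "1 \<le> k" "k < n"
    | k where "n = 2 * k - 1" "1 < k" "k < n"
  proof -
    show ?thesis
    proof (cases "even n")
      case True
      then show ?thesis using that(2)[of "n div 2"] less.prems by auto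
    next
      case False
      then obtain q where "n = 2 * q + 1" by (auto elim: oddE)
      then show ?thesis using that(1) that(3)[of "q + 1"] by (cases "q = 0") auto
    qed
  qed
  then show ?case
  proof cases
    case 1
    have "?P n = {y. 0 \<le> fst (snd y) + - c} \<inter> {y. 0 \<le> fst y + 0} \<inter> {y. 0 \<le> snd (snd y) - fst y + 0}"
      using assms 1 by (auto simp: field_simps)
    then show ?thesis
      by (simp only:) (intro soc_representable_Int soc_representable_halfspace linearI; simp add: algebra_simps)
  next
    case (2 k)
    have "?P n = {y. \<exists>w. (y, w) \<in>
        {y. (fst (fst y), fst (snd (fst y)), snd y) + 0 \<in> ?P k} \<inter>
        {y. 0 \<le> fst (snd (fst y)) \<and> 0 \<le> snd (snd (fst y)) \<and>
          (snd y)\<^sup>2 \<le> fst (snd (fst y)) * snd (snd (fst y))}}" (is "_ = {y. \<exists>w. (y, w) \<in> ?Q}")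
    proof (intro set_eqI iffI; clarsimp)
      fix b x z assume h: "c \<le> x" "0 \<le> b" "x * (b / x) ^ n \<le> z"
      have x: "0 < x" using h assms by simp
      have "0 \<le> x * (b / x) ^ n" using x h by simp
      then have "0 \<le> z" using h by simp
      moreover have "(x * (b / x) ^ k)\<^sup>2 = x * (x * (b / x) ^ n)"
        by (simp add: 2 power_mult power2_eq_square power_mult_distrib mult_ac)
      moreover have "\<dots> \<le> x * z" using h x by simp
      ultimately show "\<exists>w. x * (b / x) ^ k \<le> w \<and> 0 \<le> x \<and> 0 \<le> z \<and> w\<^sup>2 \<le> x * z"
        using x h by (intro exI[of _ "x * (b / x) ^ k"]) auto
    next
      fix b x z w assume h: "c \<le> x" "0 \<le> b" "x * (b / x) ^ k \<le> w" "w\<^sup>2 \<le> x * z"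
      have x: "0 < x" using h assms by simp
      have "x * (x * (b / x) ^ n) = (x * (b / x) ^ k)\<^sup>2"
        by (simp add: 2 power_mult power2_eq_square power_mult_distrib mult_ac)
      also have "\<dots> \<le> w\<^sup>2" using h x by (intro power_mono) auto
      also have "\<dots> \<le> x * z" by fact
      finally show "x * (b / x) ^ n \<le> z" using x by simp
    qed
    moreover have "soc_representable ?Q"
      using less.IH[of k] 2
      by (intro soc_representable_Int soc_representable_vimage[OF lin] soc_representable_rotated_cone linearI) auto
    ultimately show ?thesis using soc_representable_project[of ?Q] by simp
  next
    case (3 k)
    have "?P n = {y. \<exists>w. (y, w) \<in>
        {y. (fst (fst y), fst (snd (fst y)), snd y) + 0 \<in> ?P k} \<inter>
        {y. 0 \<le> fst (fst y) \<and> 0 \<le> snd (snd (fst y)) \<and>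
          (snd y)\<^sup>2 \<le> fst (fst y) * snd (snd (fst y))}}" (is "_ = {y. \<exists>w. (y, w) \<in> ?Q}")
    proof (intro set_eqI iffI; clarsimp)
      fix b x z assume h: "c \<le> x" "0 \<le> b" "x * (b / x) ^ n \<le> z"
      have x: "0 < x" using h assms by simp
      have "0 \<le> x * (b / x) ^ n" using x h by simp
      then have "0 \<le> z" using h by simp
      moreover have "(x * (b / x) ^ k)\<^sup>2 = b * (x * (b / x) ^ n)"
      proof -
        have "(x * (b / x) ^ k)\<^sup>2 = x\<^sup>2 * (b / x) ^ Suc n"
          using 3 by (simp add: power_mult_distrib mult.commute flip: power_mult power_Suc)
        then show ?thesis using x by (simp add: power2_eq_square)
      qed
      moreover have "\<dots> \<le> b * z" using h x by (intro mult_left_mono) auto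
      ultimately show "\<exists>w. x * (b / x) ^ k \<le> w \<and> 0 \<le> z \<and> w\<^sup>2 \<le> b * z"
        using x h by (intro exI[of _ "x * (b / x) ^ k"]) auto
    next
      fix b x z w assume h: "c \<le> x" "0 \<le> b" "x * (b / x) ^ k \<le> w" "w\<^sup>2 \<le> b * z" "0 \<le> z"
      have x: "0 < x" using h assms by simp
      \<comment> \<open>The cone inequality carries a factor \<open>b\<close>, which cancels unless
        \<open>b = 0\<close>; in that case the left side is 0 because \<open>n > 0\<close>.\<close>
      show "x * (b / x) ^ n \<le> z"
      proof (cases "b = 0")
        case True
        then show ?thesis using 3 h by (simp add: power_0_left)
      next
        case False
        have "b * (x * (b / x) ^ n) = (x * (b / x) ^ k)\<^sup>2"
        proof -
          have "(x * (b / x) ^ k)\<^sup>2 = x\<^sup>2 * (b / x) ^ Suc n"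
            using 3 by (simp add: power_mult_distrib mult.commute flip: power_mult power_Suc)
          then show ?thesis using x by (simp add: power2_eq_square)
        qed
        also have "\<dots> \<le> w\<^sup>2" using h x by (intro power_mono) auto
        also have "\<dots> \<le> b * z" by fact
        finally show ?thesis using False h by simp
      qed
    qed
    moreover have "soc_representable ?Q"
      using less.IH[of k] 3
      by (intro soc_representable_Int soc_representable_vimage[OF lin] soc_representable_rotated_cone linearI) auto
    ultimately show ?thesis using soc_representable_project[of ?Q] by simp
  qed
qed

text \<open>An even power depends only on the absolute value of \<open>v\<close>. An auxiliary
  \<open>w\<close> bounds it from above by the two half-spaces \<open>v \<le> w\<close> and
  \<open>- v \<le> w\<close>, and monotonicity on the nonnegative reals does the rest.\<close>

lemma soc_representable_even_pow:
  assumes "0 < (c::real)" "1 \<le> n" "even n"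
  shows "soc_representable {(v, x, z). c \<le> x \<and> x * (v / x) ^ n \<le> z}"
proof -
  let ?P = "{(b, x, z). c \<le> x \<and> 0 \<le> b \<and> x * (b / x) ^ n \<le> z}"
  let ?L = "\<lambda>y :: (real \<times> real \<times> real) \<times> real. (snd y, fst (snd (fst y)), snd (snd (fst y)))"
  have lin: "linear ?L" by (intro linearI) auto
  have "{(v, x, z). c \<le> x \<and> x * (v / x) ^ n \<le> z} = {y. \<exists>w. (y, w) \<in>
      {y. ?L y + 0 \<in> ?P} \<inter> {y. 0 \<le> (snd y - fst (fst y)) + 0} \<inter> {y. 0 \<le> (snd y + fst (fst y)) + 0}}"
    (is "_ = {y. \<exists>w. (y, w) \<in> ?Q}")
  proof (intro set_eqI iffI; clarsimp)
    fix v x z assume h: "c \<le> x" "x * (v / x) ^ n \<le> z"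
    moreover have "(\<bar>v\<bar> / x) ^ n = (v / x) ^ n"
      using assms by (simp add: power_divide power_even_abs)
    ultimately show "\<exists>w\<ge>0. x * (w / x) ^ n \<le> z \<and> v \<le> w \<and> 0 \<le> w + v"
      by (intro exI[of _ "\<bar>v\<bar>"]) auto
  next

    fix v x z w assume h: "c \<le> x" "x * (w / x) ^ n \<le> z" "v \<le> w" "0 \<le> w + v"
    have x: "0 < x" using h assms by simp
    have "(v / x) ^ n = (\<bar>v\<bar> / x) ^ n"
      using assms by (simp add: power_divide power_even_abs)
    also have "\<dots> \<le> (w / x) ^ n"
      using x h by (intro power_mono divide_right_mono) auto
    finally have "x * (v / x) ^ n \<le> x * (w / x) ^ n" using x by simp
    with h show "x * (v / x) ^ n \<le> z" by simp
  qed
  moreover have "soc_representable ?Q"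
    by (intro soc_representable_Int soc_representable_vimage[OF lin] soc_representable_halfspace
        soc_representable_nonneg_pow assms linearI) (auto simp: algebra_simps)
  ultimately show ?thesis using soc_representable_project[of ?Q] by simp
qed

text \<open>A shift of the argument is linear after homogenization:
  \<open>v / x + u = (v + u * x) / x\<close>. Each node gets its own bound \<open>t\<close>, and as
  \<open>w a\<close> is nonnegative, the rest of the sum may use the budget
  \<open>z - w a * t\<close>.\<close>

lemma soc_representable_sum_even_pow:
  fixes w :: "real \<Rightarrow> real"
  assumes "0 < c" "1 \<le> n" "even n" "finite S" "\<And>u. u \<in> S \<Longrightarrow> 0 \<le> w u"
  shows "soc_representable {(v, x, z). c \<le> x \<and> x * (\<Sum>u\<in>S. w u * (v / x + u) ^ n) \<le> z}"
  using assms(4,5)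
proof (induction S rule: finite_induct)
  case empty
  have "{(v, x, z). c \<le> x \<and> x * (\<Sum>u\<in>{}. w u * (v / x + u) ^ n) \<le> z}
     = {y :: real \<times> real \<times> real. 0 \<le> fst (snd y) + - c} \<inter> {y. 0 \<le> snd (snd y) + 0}" by auto
  then show ?case
    by (simp only:) (intro soc_representable_Int soc_representable_halfspace linearI; simp)
next
  case (insert a S)
  let ?F = "\<lambda>S. {(v, x, z). c \<le> x \<and> x * (\<Sum>u\<in>S. w u * (v / x + u) ^ n) \<le> z}"
  let ?E = "{(v, x, z). c \<le> x \<and> x * (v / x) ^ n \<le> z}"
  let ?A = "\<lambda>y :: (real \<times> real \<times> real) \<times> real.
    (fst (fst y) + a * fst (snd (fst y)), fst (snd (fst y)), snd y)"
  let ?B = "\<lambda>y :: (real \<times> real \<times> real) \<times> real.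
    (fst (fst y), fst (snd (fst y)), snd (snd (fst y)) - w a * snd y)"
  have lin: "linear ?A" "linear ?B" by (intro linearI; simp add: algebra_simps)+
  have wa: "0 \<le> w a" using insert by auto
  have "?F (insert a S) = {y. \<exists>t. (y, t) \<in> {y. ?A y + 0 \<in> ?E} \<inter> {y. ?B y + 0 \<in> ?F S}}"
    (is "_ = {y. \<exists>w. (y, w) \<in> ?Q}")
  proof (intro set_eqI iffI; clarsimp simp: insert.hyps)
    fix v x z assume h: "c \<le> x" "x * (w a * (v / x + a) ^ n + (\<Sum>u\<in>S. w u * (v / x + u) ^ n)) \<le> z"
    have x: "0 < x" using h assms by simp
    then have "(v + a * x) / x = v / x + a" by (simp add: field_simps)
    then show "\<exists>t. x * ((v + a * x) / x) ^ n \<le> t \<and>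
        x * (\<Sum>u\<in>S. w u * (v / x + u) ^ n) \<le> z - w a * t"
      using h by (intro exI[of _ "x * (v / x + a) ^ n"]) (auto simp: algebra_simps)
  next
    fix v x z t assume h: "c \<le> x" "x * ((v + a * x) / x) ^ n \<le> t"
        "x * (\<Sum>u\<in>S. w u * (v / x + u) ^ n) \<le> z - w a * t"
    have x: "0 < x" using h assms by simp
    then have "(v + a * x) / x = v / x + a" by (simp add: field_simps)
    then have "w a * (x * (v / x + a) ^ n) \<le> w a * t"
      using h wa by (intro mult_left_mono) auto
    with h show "x * (w a * (v / x + a) ^ n + (\<Sum>u\<in>S. w u * (v / x + u) ^ n)) \<le> z"
      by (simp add: algebra_simps)
  qed
  moreover have "soc_representable ?Q"
    using insert.IH insert.prems
    by (intro soc_representable_Int soc_representable_vimage lin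
        soc_representable_even_pow assms) auto
  ultimately show ?case using soc_representable_project[of ?Q] by simp
qed

text \<open>An auxiliary \<open>r\<close> with
  \<open>x2 * psi_hat (2 * s) (x3 / 2 ^ N / x2) \<le> r\<close> separates the inner polynomial from
  the outer power \<open>2 ^ N\<close>. As a nonnegative combination of even powers the polynomial
  is nonnegative, where the outer power is monotone.\<close>

lemma soc_representable_K_sc:
  assumes "1 < M" "1 \<le> s" "s \<le> 33"
  shows "soc_representable (K_sc M N (2 * s))"
proof -
  have "2 * s \<le> 66" using assms by simp
  then obtain S :: "real set" and w where S: "finite S" "\<And>u. u \<in> S \<Longrightarrow> 0 \<le> w u"
      and psi: "\<And>y. psi_hat (2 * s) y = (\<Sum>u\<in>S. w u * (y + u) ^ (2 * s))"
    using psi_hat_eq_sum_shifted_powers by metis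
  have psi_nonneg: "0 \<le> psi_hat (2 * s) y" for y
    unfolding psi by (intro sum_nonneg mult_nonneg_nonneg S) (auto simp: zero_le_even_power)
  let ?P = "{(b, x, z). 1 / M \<le> x \<and> 0 \<le> b \<and> x * (b / x) ^ 2 ^ N \<le> z}"
  let ?F = "{(v, x, z). 1 / M \<le> x \<and> x * psi_hat (2 * s) (v / x) \<le> z}"
  let ?A = "\<lambda>y :: (real \<times> real \<times> real) \<times> real. (snd y, fst (snd (fst y)), fst (fst y))"
  let ?B = "\<lambda>y :: (real \<times> real \<times> real) \<times> real. (snd (snd (fst y)) / 2 ^ N, fst (snd (fst y)), snd y)"
  have lin: "linear ?A" "linear ?B" by (intro linearI; simp add: add_divide_distrib)+
  \<comment> \<open>\<open>?A\<close> puts \<open>r\<close> into the outer power with bound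
    \<open>x1\<close>, and \<open>?B\<close> puts \<open>x3 / 2 ^ N\<close> into the polynomial with
    bound \<open>r\<close>. The half-spaces supply the bounds of \<open>cone_dom M\<close> other
    than \<open>1 / M \<le> x2\<close>, which \<open>?P\<close> and \<open>?F\<close>
    contain.\<close>
  have eq: "K_sc M N (2 * s) = {y. \<exists>r. (y, r) \<in> {y. ?A y + 0 \<in> ?P} \<inter> {y. ?B y + 0 \<in> ?F}} \<inter>
      ({y. 0 \<le> fst y + - (1 / M)} \<inter> {y. 0 \<le> - fst y + M} \<inter> {y. 0 \<le> - fst (snd y) + M})"
    (is "_ = {y. \<exists>r. (y, r) \<in> ?Q} \<inter> ?D")
  proof -
    have "psi_bar N (2 * s) (x3 / x2) \<le> x1 / x2 \<longleftrightarrow>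
        (\<exists>r\<ge>0. x2 * (r / x2) ^ 2 ^ N \<le> x1 \<and> x2 * psi_hat (2 * s) (x3 / 2 ^ N / x2) \<le> r)"
      if "1 / M \<le> x2" for x1 x2 x3
    proof -
      have x2: "0 < x2" using that assms by (smt (verit) divide_pos_pos)
      define q where "q = psi_hat (2 * s) (x3 / 2 ^ N / x2)"
      have q: "0 \<le> q" by (simp add: q_def psi_nonneg)
      have "psi_bar N (2 * s) (x3 / x2) = q ^ 2 ^ N"
        by (simp add: psi_bar_def q_def mult.commute)
      moreover have "q ^ 2 ^ N \<le> x1 / x2" if "0 \<le> r" "x2 * (r / x2) ^ 2 ^ N \<le> x1" "x2 * q \<le> r" for r
      proof -
        have "q ^ 2 ^ N \<le> (r / x2) ^ 2 ^ N"
          using x2 q that by (intro power_mono) (auto simp: field_simps)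
        also have "\<dots> \<le> x1 / x2" using that x2 by (simp add: pos_le_divide_eq mult.commute)
        finally show ?thesis .
      qed
      moreover have "\<exists>r\<ge>0. x2 * (r / x2) ^ 2 ^ N \<le> x1 \<and> x2 * q \<le> r" if "q ^ 2 ^ N \<le> x1 / x2"
        using that x2 q by (intro exI[of _ "x2 * q"]) (auto simp: pos_le_divide_eq mult.commute)
      ultimately show ?thesis unfolding q_def[symmetric] by auto
    qed
    then show ?thesis by (auto simp: K_sc_def cone_dom_def)
  qed
  have Q: "soc_representable ?Q"
  proof (intro soc_representable_Int soc_representable_vimage lin)
    show "soc_representable ?P"
      using assms by (intro soc_representable_nonneg_pow) auto
    show "soc_representable ?F"
      unfolding psi using assms by (intro soc_representable_sum_even_pow S) auto
  qed
  have D: "soc_representable ?D"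
    by (intro soc_representable_Int soc_representable_halfspace linearI) auto
  show ?thesis
    unfolding eq by (rule soc_representable_Int[OF soc_representable_project[OF Q] D])
qed

section \<open>The explicit cone description for degree two\<close>

text \<open>Repeated squaring along the chain bounds \<open>(r k / x) ^ 2 ^ k\<close> by
  \<open>p / x\<close> for every \<open>k\<close>. Taking \<open>k = N\<close> gives one direction;
  the other takes the chain as tight as possible.\<close>

lemma square_chain_iff:
  fixes x p q :: real
  assumes "0 < x" "0 \<le> q" "1 \<le> N"
  shows "(\<exists>r. (\<forall>k\<in>{1..N-1}. 0 \<le> r k) \<and> (r 1)\<^sup>2 \<le> p * x \<and>
      (\<forall>k\<in>{1..N-1}. (r (k + 1))\<^sup>2 \<le> r k * x) \<and> x * q \<le> r N) \<longleftrightarrow> q ^ 2 ^ N \<le> p / x"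
    (is "?L \<longleftrightarrow> ?R")
proof
  assume ?L
  then obtain r where r: "(r 1)\<^sup>2 \<le> p * x" "x * q \<le> r N"
      and step: "\<And>k. k \<in> {1..N-1} \<Longrightarrow> (r (k + 1))\<^sup>2 \<le> r k * x" by blast
  have "(r k / x) ^ 2 ^ k \<le> p / x" if "1 \<le> k" "k \<le> N" for k
    using that
  proof (induction k rule: nat_induct_at_least)
    case base
    then show ?case using r(1) assms by (simp add: power2_eq_square field_simps)
  next
    case (Suc k)
    have "(r (Suc k) / x) ^ 2 ^ Suc k = ((r (Suc k) / x)\<^sup>2) ^ 2 ^ k"
      by (simp flip: power_mult)
    also have "\<dots> \<le> (r k / x) ^ 2 ^ k"
      using step[of k] Suc assms by (intro power_mono) (auto simp: power2_eq_square field_simps)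
    also have "\<dots> \<le> p / x" using Suc by simp
    finally show ?case .
  qed
  moreover have "q ^ 2 ^ N \<le> (r N / x) ^ 2 ^ N"
    using r(2) assms by (intro power_mono) (auto simp: field_simps)
  ultimately show ?R using assms by (meson order_refl order_trans)
next
  assume ?R
  \<comment> \<open>With this choice every inequality of the chain but the first is an equality, and
    the first is the assumed bound on \<open>q ^ 2 ^ N\<close>.\<close>
  define r where "r k = x * q ^ 2 ^ (N - k)" for k
  have sq: "(r (k + 1))\<^sup>2 = x * q ^ 2 ^ (N - k) * x" if "k < N" for k
  proof -
    have "2 ^ (N - k) = (2 ^ (N - (k + 1)) * 2 :: nat)"
      using that by (metis Suc_diff_Suc Suc_eq_plus1 power_Suc2)
    then show ?thesis
      by (simp add: r_def power_mult_distrib power_mult power2_eq_square)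
  qed
  show ?L
  proof (intro exI[of _ r] conjI ballI)
    show "(r 1)\<^sup>2 \<le> p * x"
      using sq[of 0] assms \<open>?R\<close> by (simp add: field_simps)
    show "(r (k + 1))\<^sup>2 \<le> r k * x" if "k \<in> {1..N-1}" for k
      using that sq[of k] by (auto simp: r_def)
  qed (use assms in \<open>auto simp: r_def\<close>)
qed

lemma psi_hat_2: "psi_hat 2 y = 1 + y + y\<^sup>2 / 2"
  by (simp add: psi_hat_def numeral_2_eq_2)

text \<open>The last cone encodes the quadratic polynomial itself, because
  \<open>(1 + h)^2 + 1 = 2 * psi_hat 2 h\<close>. The other cones are the rotated cones of
  \<open>square_chain_iff\<close> with \<open>p = x1\<close> and \<open>x = x2\<close>.\<close>

lemma K_sc_2_eq:
  assumes "1 < M" "1 \<le> N"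
  shows "K_sc M N 2 =
       {(x1, x2, x3) \<in> cone_dom M. \<exists>r :: nat \<Rightarrow> real.
          (\<forall>k\<in>{1..N-1}. r k \<ge> 0) \<and>
          [2 * r 1, x1 - x2, x1 + x2] \<in> lorentz_cone 3 \<and>
          (\<forall>k\<in>{1..N-1}. [2 * r (k + 1), r k - x2, r k + x2] \<in> lorentz_cone 3) \<and>
          [x2 + x3 / 2 ^ N, r N - x2, r N] \<in> lorentz_cone 3}"
proof -
  have iff: "psi_bar N 2 (x3 / x2) \<le> x1 / x2 \<longleftrightarrow> (\<exists>r :: nat \<Rightarrow> real.
          (\<forall>k\<in>{1..N-1}. r k \<ge> 0) \<and>
          [2 * r 1, x1 - x2, x1 + x2] \<in> lorentz_cone 3 \<and>
          (\<forall>k\<in>{1..N-1}. [2 * r (k + 1), r k - x2, r k + x2] \<in> lorentz_cone 3) \<and>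
          [x2 + x3 / 2 ^ N, r N - x2, r N] \<in> lorentz_cone 3)"
    if "0 < x1" "0 < x2" for x1 x2 x3
  proof -
    define h where "h = x3 / x2 / 2 ^ N"
    have x3: "x3 / 2 ^ N = h * x2" using that by (simp add: h_def)
    have psi: "0 \<le> psi_hat 2 h"
      using zero_le_power2[of "1 + h"] by (simp add: psi_hat_2 power2_eq_square algebra_simps)
    have last: "[x2 + x3 / 2 ^ N, t - x2, t] \<in> lorentz_cone 3 \<longleftrightarrow> x2 * psi_hat 2 h \<le> t" for t
    proof -
      have "(x2 + h * x2)\<^sup>2 + (t - x2)\<^sup>2 - t\<^sup>2 = 2 * x2 * (x2 * psi_hat 2 h - t)"
        by (simp add: psi_hat_2 power2_eq_square field_simps)
      moreover have "2 * x2 * (x2 * psi_hat 2 h - t) \<le> 0 \<longleftrightarrow> x2 * psi_hat 2 h \<le> t"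
        using that by (simp add: mult_le_0_iff)
      moreover have "0 \<le> t" if "x2 * psi_hat 2 h \<le> t"
        using that psi \<open>0 < x2\<close> by (meson less_imp_le mult_nonneg_nonneg order_trans)
      ultimately show ?thesis unfolding lorentz_cone_3_iff' x3 by auto
    qed
    have "psi_bar N 2 (x3 / x2) = psi_hat 2 h ^ 2 ^ N"
      by (simp add: psi_bar_def h_def)
    then show ?thesis
      using square_chain_iff[OF \<open>0 < x2\<close> psi assms(2), of x1] that
      unfolding last rotated_lorentz_cone_iff by (auto simp: less_imp_le)
  qed
  have pos: "0 < x1 \<and> 0 < x2" if "(x1, x2, x3) \<in> cone_dom M" for x1 x2 x3
    using that assms by (auto simp: cone_dom_def intro: less_le_trans[of 0 "1 / M"])
  show ?thesis
    unfolding K_sc_def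
  proof (intro set_eqI)
    fix z :: "real \<times> real \<times> real"
    obtain x1 x2 x3 where z: "z = (x1, x2, x3)" by (cases z)
    show "z \<in> {(x1, x2, x3) \<in> cone_dom M. psi_bar N 2 (x3 / x2) \<le> x1 / x2} \<longleftrightarrow>
      z \<in> {(x1, x2, x3) \<in> cone_dom M. \<exists>r :: nat \<Rightarrow> real.
          (\<forall>k\<in>{1..N-1}. r k \<ge> 0) \<and>
          [2 * r 1, x1 - x2, x1 + x2] \<in> lorentz_cone 3 \<and>
          (\<forall>k\<in>{1..N-1}. [2 * r (k + 1), r k - x2, r k + x2] \<in> lorentz_cone 3) \<and>
          [x2 + x3 / 2 ^ N, r N - x2, r N] \<in> lorentz_cone 3}"
      using iff[of x1 x2 x3] pos[of x1 x2 x3] unfolding z by auto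
  qed
qed

section \<open>Approximation of the exponential cone\<close>

text \<open>Relative to \<open>exp h\<close>, the Taylor remainder is at most
  \<open>\<delta> / 2\<close>: its exponential factor is at most \<open>exp 1 \<le> 3\<close>, and
  the factorial is at least \<open>fact 3 = 6\<close>. Stating the error in the exponent makes it
  easy to raise to the power \<open>2 ^ N\<close>.\<close>

lemma psi_hat_exp_bounds:
  fixes h :: real
  assumes "1 \<le> s" "\<bar>h\<bar> \<le> 1 / 2"
  defines "\<delta> \<equiv> \<bar>h\<bar> ^ (2 * s + 1)"
  shows "exp (h - \<delta>) \<le> psi_hat (2 * s) h" "psi_hat (2 * s) h \<le> exp (h + \<delta>)"
proof -
  obtain t where t: "\<bar>t\<bar> \<le> \<bar>h\<bar>"
    and eq: "exp h = (\<Sum>m<2 * s + 1. h ^ m / fact m) + exp t / fact (2 * s + 1) * h ^ (2 * s + 1)"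
    using Maclaurin_exp_le by blast
  define E where "E = exp t / fact (2 * s + 1) * h ^ (2 * s + 1)"
  have psi: "psi_hat (2 * s) h = exp h - E"
    using eq unfolding E_def psi_hat_def by (simp add: lessThan_Suc_atMost atMost_atLeast0 del: fact_Suc)
  have "(6::real) = fact 3" by (simp add: fact_numeral)
  also have "(fact 3 :: real) \<le> fact (2 * s + 1)"
    using assms by (intro fact_mono) auto
  finally have six: "6 \<le> (fact (2 * s + 1) :: real)" .
  have d0: "0 \<le> \<delta>" by (simp add: \<delta>_def)
  have "\<delta> \<le> \<bar>h\<bar> ^ 1"
    unfolding \<delta>_def using assms by (intro power_decreasing) auto
  with assms have d1: "\<delta> \<le> 1 / 2" by simp
  have "exp (t - h) \<le> exp 1"
    using t assms by simp
  also have "\<dots> \<le> (3::real)" by (rule exp_le)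
  finally have e3: "exp (t - h) \<le> 3" .
  have "\<bar>E\<bar> = exp h * (exp (t - h) / fact (2 * s + 1) * \<delta>)"
    by (simp add: E_def \<delta>_def abs_mult power_abs exp_diff del: fact_Suc power_Suc)
  also have "\<dots> \<le> exp h * (3 / 6 * \<delta>)"
    using e3 six d0 by (intro mult_left_mono mult_right_mono frac_le) auto
  finally have E: "\<bar>E\<bar> \<le> exp h * (\<delta> / 2)" by simp
  have "psi_hat (2 * s) h \<le> exp h * (1 + \<delta>)"
    unfolding psi using E d0 mult_nonneg_nonneg[of "exp h" \<delta>] by (simp add: algebra_simps)
  also have "\<dots> \<le> exp (h + \<delta>)"
    by (simp add: exp_add exp_ge_add_one_self)
  finally show "psi_hat (2 * s) h \<le> exp (h + \<delta>)" .
  \<comment> \<open>The product is \<open>1 + (\<delta> - \<delta>^2) / 2\<close>. It turns the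
    factor \<open>1 - \<delta> / 2\<close> into the lower bound
    \<open>exp (- \<delta>)\<close>.\<close>
  have "1 \<le> (1 - \<delta> / 2) * (1 + \<delta>)"
  proof -
    have "\<delta> * \<delta> \<le> \<delta> * 1" using d0 d1 by (intro mult_left_mono) auto
    then show ?thesis by (simp add: algebra_simps)
  qed
  also have "\<dots> \<le> (1 - \<delta> / 2) * exp \<delta>"
    using d0 d1 by (intro mult_left_mono) (auto simp: exp_ge_add_one_self)
  finally have "1 / exp \<delta> \<le> 1 - \<delta> / 2"
    by (simp add: pos_divide_le_eq)
  then have "exp (h - \<delta>) \<le> exp h * (1 - \<delta> / 2)"
    using mult_left_mono[of "1 / exp \<delta>" "1 - \<delta> / 2" "exp h"] by (simp add: exp_diff)
  also have "\<dots> \<le> psi_hat (2 * s) h"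
    unfolding psi using E by (simp add: algebra_simps)
  finally show "exp (h - \<delta>) \<le> psi_hat (2 * s) h" .
qed

text \<open>The outer power multiplies the exponents \<open>h - \<delta>\<close> and
  \<open>h + \<delta>\<close> by \<open>2 ^ N\<close>. The condition on \<open>N\<close> has two
  purposes: it makes \<open>h\<close> small enough for the Taylor bounds, and it keeps
  \<open>2 ^ N * \<delta>\<close> below \<open>\<epsilon>\<close>.\<close>

lemma psi_bar_exp_bounds:
  fixes y B \<epsilon> :: real
  assumes "1 \<le> s" "\<bar>y\<bar> \<le> B" "0 < \<epsilon>" "\<epsilon> < B"
    and N: "4 ^ s * B ^ (2 * s + 1) / \<epsilon> \<le> 2 ^ (2 * s * N)"
  shows "exp (y - \<epsilon>) \<le> psi_bar N (2 * s) y" "psi_bar N (2 * s) y \<le> exp (y + \<epsilon>)"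
proof -
  define h where "h = y / 2 ^ N"
  define \<delta> where "\<delta> = \<bar>h\<bar> ^ (2 * s + 1)"
  \<comment> \<open>Here the factor \<open>4 ^ s\<close> and \<open>\<epsilon> < B\<close> enter:
    taking the root of order \<open>2 * s\<close> gives \<open>2 * B \<le> 2 ^ N\<close>.\<close>
  have "(2 * B) ^ (2 * s) \<le> (2 * B) ^ (2 * s) * (B / \<epsilon>)"
    using mult_left_mono[of 1 "B / \<epsilon>" "(2 * B) ^ (2 * s)"] assms by simp
  also have "\<dots> = 4 ^ s * B ^ (2 * s + 1) / \<epsilon>"
    by (simp add: power_mult_distrib power_mult)
  also have "\<dots> \<le> (2 ^ N) ^ (2 * s)"
    using N by (simp add: power_mult[symmetric] mult_ac)
  finally have "2 * B \<le> 2 ^ N"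
    using assms by (subst (asm) power_mono_iff) auto
  with assms(2) have h: "\<bar>h\<bar> \<le> 1 / 2" by (simp add: h_def field_simps)
  have "B ^ (2 * s + 1) \<le> 4 ^ s * B ^ (2 * s + 1)"
    using mult_right_mono[of 1 "4 ^ s" "B ^ (2 * s + 1)"] assms by simp
  also have "\<dots> \<le> \<epsilon> * 2 ^ (2 * s * N)"
    using N assms by (simp add: field_simps)
  finally have BN: "B ^ (2 * s + 1) \<le> \<epsilon> * 2 ^ (2 * s * N)" .
  have "2 ^ N * \<delta> = \<bar>y\<bar> ^ (2 * s + 1) / 2 ^ (2 * s * N)"
    by (simp add: \<delta>_def h_def power_divide field_simps flip: power_mult power_add)
  also have "\<dots> \<le> B ^ (2 * s + 1) / 2 ^ (2 * s * N)"
    using assms by (intro divide_right_mono power_mono) auto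
  also have "\<dots> \<le> \<epsilon>"
    using BN by (simp add: field_simps)
  finally have d: "2 ^ N * \<delta> \<le> \<epsilon>" .
  note b = psi_hat_exp_bounds[OF assms(1) h, folded \<delta>_def]
  have "exp (y - \<epsilon>) \<le> exp (2 ^ N * (h - \<delta>))"
    using d by (simp add: h_def algebra_simps)
  also have "\<dots> = exp (h - \<delta>) ^ 2 ^ N"
    by (simp add: exp_of_nat_mult[of "2 ^ N" "h - \<delta>", simplified])
  also have "\<dots> \<le> psi_bar N (2 * s) y"
    unfolding psi_bar_def h_def[symmetric] using b by (intro power_mono) auto
  finally show "exp (y - \<epsilon>) \<le> psi_bar N (2 * s) y" .
  have "psi_bar N (2 * s) y \<le> exp (h + \<delta>) ^ 2 ^ N"
    unfolding psi_bar_def h_def[symmetric]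
    using b by (intro power_mono) (auto intro: order_trans[OF exp_ge_zero])
  also have "\<dots> = exp (2 ^ N * (h + \<delta>))"
    by (simp add: exp_of_nat_mult[of "2 ^ N" "h + \<delta>", simplified])
  also have "\<dots> \<le> exp (y + \<epsilon>)"
    using d by (simp add: h_def algebra_simps)
  finally show "psi_bar N (2 * s) y \<le> exp (y + \<epsilon>)" .
qed

text \<open>On the slab, \<open>x2 \<ge> 1 / M\<close> gives
  \<open>\<bar>x3 / x2\<bar> \<le> M * (2 * M * ln M) = B\<close>, so the bounds on
  \<open>psi_bar\<close> apply. A negative parameter of \<open>K_exp\<close> raises the threshold
  and so gives the smaller cone.\<close>

lemma K_sc_between_K_exp:
  assumes "1 \<le> s" "1 < M" "0 < \<epsilon>" "\<epsilon> < B" and B: "B = 2 * M\<^sup>2 * ln M"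
    and N: "4 ^ s * B ^ (2 * s + 1) / \<epsilon> \<le> 2 ^ (2 * s * N)"
  shows "K_exp M (-\<epsilon>) \<inter> x3_slab M \<subseteq> K_sc M N (2 * s) \<inter> x3_slab M"
    and "K_sc M N (2 * s) \<inter> x3_slab M \<subseteq> K_exp M \<epsilon> \<inter> x3_slab M"
proof -
  have "exp (x3 / x2 - \<epsilon>) \<le> psi_bar N (2 * s) (x3 / x2) \<and> psi_bar N (2 * s) (x3 / x2) \<le> exp (x3 / x2 + \<epsilon>)"
    if "1 / M \<le> x2" "- 2 * M * ln M \<le> x3" "x3 \<le> 2 * M * ln M" for x2 x3
  proof -
    have x2: "0 < x2" using that assms by (smt (verit) divide_pos_pos)
    have "1 \<le> M * x2" using that assms by (simp add: field_simps)
    then have "2 * M * ln M * 1 \<le> 2 * M * ln M * (M * x2)"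
      using assms by (intro mult_left_mono) auto
    then have "\<bar>x3\<bar> \<le> B * x2" using that unfolding B by (simp add: power2_eq_square algebra_simps)
    then have "\<bar>x3 / x2\<bar> \<le> B" using x2 by (simp add: field_simps)
    then show ?thesis using psi_bar_exp_bounds[OF assms(1) _ assms(3,4) N] by simp
  qed
  then show "K_exp M (-\<epsilon>) \<inter> x3_slab M \<subseteq> K_sc M N (2 * s) \<inter> x3_slab M"
    and "K_sc M N (2 * s) \<inter> x3_slab M \<subseteq> K_exp M \<epsilon> \<inter> x3_slab M"
    by (fastforce simp: K_exp_def K_sc_def x3_slab_def cone_dom_def)+
qed

section \<open>The number of squarings and its growth\<close>

text \<open>Solves the condition of \<open>K_sc_between_K_exp\<close> for \<open>N\<close> by
  logarithms. \<open>nat\<close> replaces a negative ceiling by 0, and the final 1 makes the result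
  positive.\<close>

definition squarings :: "nat \<Rightarrow> real \<Rightarrow> real \<Rightarrow> nat" where
  "squarings s M \<epsilon> = nat \<lceil>log 2 (4 ^ s * (2 * M\<^sup>2 * ln M) ^ (2 * s + 1) / \<epsilon>) / (2 * real s)\<rceil> + 1"

lemma squarings_sufficient:
  assumes "1 \<le> s" "1 < M" "0 < \<epsilon>"
  shows "4 ^ s * (2 * M\<^sup>2 * ln M) ^ (2 * s + 1) / \<epsilon> \<le> 2 ^ (2 * s * squarings s M \<epsilon>)"
proof -
  define A where "A = 4 ^ s * (2 * M\<^sup>2 * ln M) ^ (2 * s + 1) / \<epsilon>"
  have A: "0 < A" using assms by (simp add: A_def)
  have "log 2 A / (2 * real s) \<le> real (squarings s M \<epsilon>)"
    unfolding squarings_def A_def[symmetric] by linarith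
  then have "log 2 A \<le> real (2 * s * squarings s M \<epsilon>)"
    using assms by (simp add: field_simps)
  then have "2 powr log 2 A \<le> 2 powr real (2 * s * squarings s M \<epsilon>)"
    by simp
  then have "A \<le> 2 ^ (2 * s * squarings s M \<epsilon>)"
    using A by (simp only: powr_realpow) simp
  then show ?thesis by (simp only: A_def)
qed

lemma squarings_le:
  assumes "1 \<le> s" "1 < M" "0 < \<epsilon>"
  shows "real (squarings s M \<epsilon>) \<le>
    \<bar>real s * ln 4 + (2 * real s + 1) * ln (2 * M\<^sup>2 * ln M) + ln (1 / \<epsilon>)\<bar> + 2"
proof -
  define A where "A = 4 ^ s * (2 * M\<^sup>2 * ln M) ^ (2 * s + 1) / \<epsilon>"
  have B: "0 < 2 * M\<^sup>2 * ln M" using assms by simp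
  have lnA: "ln A = real s * ln 4 + (2 * real s + 1) * ln (2 * M\<^sup>2 * ln M) + ln (1 / \<epsilon>)"
  proof -
    have "ln A = ln (4 ^ s) + ln ((2 * M\<^sup>2 * ln M) ^ (2 * s + 1)) + ln (1 / \<epsilon>)"
      unfolding A_def using B assms by (simp only: ln_mult ln_div zero_less_power zero_less_mult_iff) (simp add: ln_mult ln_div)
    also have "ln ((2 * M\<^sup>2 * ln M) ^ (2 * s + 1)) = (2 * real s + 1) * ln (2 * M\<^sup>2 * ln M)"
      by (subst ln_realpow) simp
    finally show ?thesis by (simp add: ln_realpow)
  qed
  have "1 \<le> 2 * real s * ln 2"
    using assms ln2_ge_two_thirds mult_mono[of 1 "real s" "2 / 3" "ln 2"] by simp
  then have "\<bar>ln A\<bar> / (2 * real s * ln 2) \<le> \<bar>ln A\<bar> / 1"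
    by (intro divide_left_mono) auto
  moreover have "\<bar>log 2 A / (2 * real s)\<bar> = \<bar>ln A\<bar> / (2 * real s * ln 2)"
    by (simp add: log_def abs_mult mult_ac)
  ultimately have "log 2 A / (2 * real s) \<le> \<bar>ln A\<bar>" by linarith
  then have "real (squarings s M \<epsilon>) \<le> \<bar>ln A\<bar> + 2"
    unfolding squarings_def A_def[symmetric] by linarith
  then show ?thesis by (simp only: lnA)
qed

lemma eventually_growthI:
  assumes "\<And>M \<epsilon>. T \<le> M + 1 / \<epsilon> \<Longrightarrow> m \<le> M \<Longrightarrow> 0 < \<epsilon> \<Longrightarrow> \<epsilon> \<le> e \<Longrightarrow> Q (M, \<epsilon>)"
  shows "eventually Q (growth m e)"
  unfolding growth_def eventually_inf_principal eventually_filtercomap_at_top_linorder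
  using assms by (intro exI[of _ T]) auto

text \<open>With \<open>P = ln (2 * M^2 * ln M)\<close> and \<open>Q = ln (1 / \<epsilon>)\<close>
  the comparison function is \<open>g = P + Q / s - l\<close>. The numerator in
  \<open>squarings_le\<close> is at most \<open>3 * s * g + c\<close>, and
  \<open>c + 2 \<le> g\<close> far out in the filter, which gives the factor
  \<open>3 * s + 1\<close>.\<close>

lemma squarings_bigo:
  assumes "1 \<le> s" "1 < m" "0 < e"
  shows "(\<lambda>(M, \<epsilon>). real (squarings s M \<epsilon>)) \<in>
    O[growth m e](\<lambda>(M, \<epsilon>). ln (M\<^sup>2 * ln M / real s) + ln (1 / \<epsilon>) / real s)"
proof -
  \<comment> \<open>\<open>p\<close> and \<open>q\<close> limit how negative \<open>P\<close> and
    \<open>Q\<close> can be when \<open>m \<le> M\<close> and \<open>\<epsilon> \<le> e\<close>;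
    \<open>c\<close> collects all bounded terms. \<open>T\<close> is twice the value whose logarithm
    forces \<open>c + 2 \<le> g\<close>, since one of \<open>M\<close> and
    \<open>1 / \<epsilon>\<close> is at least \<open>T / 2\<close>.\<close>
  define p where "p = \<bar>ln (2 * m * ln m)\<bar>"
  define q where "q = \<bar>ln e\<bar>"
  define l where "l = ln (2 * real s)"
  define c where "c = 4 * real s * (p + q + l + ln 4 + 1)"
  define T where "T = 2 * exp (real s * (c + 2 + p + l) + q)"
  have nonneg: "0 \<le> p" "0 \<le> q" "0 \<le> l" "0 \<le> ln (4::real)"
    using assms by (auto simp: p_def q_def l_def)
  have s1: "1 \<le> real s" using assms by simp
  have c0: "0 \<le> c" using nonneg by (simp add: c_def)
  have "real (squarings s M \<epsilon>) \<le> (3 * real s + 1) * (ln (M\<^sup>2 * ln M / real s) + ln (1 / \<epsilon>) / real s)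
      \<and> 0 \<le> ln (M\<^sup>2 * ln M / real s) + ln (1 / \<epsilon>) / real s"
    if T: "T \<le> M + 1 / \<epsilon>" and M: "m \<le> M" and \<epsilon>: "0 < \<epsilon>" "\<epsilon> \<le> e" for M \<epsilon>
  proof -
    define P where "P = ln (2 * M\<^sup>2 * ln M)"
    define Q where "Q = ln (1 / \<epsilon>)"
    define g where "g = ln (M\<^sup>2 * ln M / real s) + Q / real s"
    have M1: "1 < M" using M assms by simp
    have g: "g = P + Q / real s - l"
      using M1 s1 by (simp add: g_def P_def l_def ln_mult ln_div)
    \<comment> \<open>Only one factor \<open>M\<close> is kept and the rest is bounded at
      \<open>m\<close>, so \<open>P\<close> grows at least like \<open>ln M\<close>.\<close>
    have "M * (2 * m * ln m) \<le> M * (2 * M * ln M)"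
      using M assms by (intro mult_left_mono mult_mono) auto
    then have "ln (M * (2 * m * ln m)) \<le> P"
      unfolding P_def using assms M1 by (intro ln_mono) (auto simp: power2_eq_square algebra_simps)
    then have P: "ln M - p \<le> P"
      using assms M1 by (simp add: ln_mult p_def)
    have "ln \<epsilon> \<le> ln e" using \<epsilon> by simp
    moreover have "Q = - ln \<epsilon>" using \<epsilon> by (simp add: Q_def ln_div)
    ultimately have Q: "- q \<le> Q" unfolding q_def by linarith
    have lnM: "0 \<le> ln M" using M1 by simp
    have "T / 2 \<le> M \<or> T / 2 \<le> 1 / \<epsilon>" using T by linarith
    moreover have "0 < M" "0 < 1 / \<epsilon>" using M1 \<epsilon> by auto
    ultimately have "real s * (c + 2 + p + l) + q \<le> ln M \<or> real s * (c + 2 + p + l) + q \<le> Q"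
      unfolding Q_def T_def by (simp only: ln_ge_iff) simp
    \<comment> \<open>Whichever of \<open>M\<close> and \<open>1 / \<epsilon>\<close> is large, the
      contribution of the other is bounded below: \<open>Q\<close> by \<open>- q\<close>, or
      \<open>P + p\<close> by 0.\<close>
    then have "real s * (c + 2 + p + l) \<le> real s * (P + p) + Q"
    proof
      assume *: "real s * (c + 2 + p + l) + q \<le> ln M"
      have "1 * ln M \<le> real s * (P + p)"
        using P s1 lnM by (intro mult_mono) auto
      with * Q show ?thesis by linarith
    next
      assume *: "real s * (c + 2 + p + l) + q \<le> Q"
      have "0 \<le> real s * (P + p)"
        using P s1 lnM by (intro mult_nonneg_nonneg) auto
      with * nonneg show ?thesis by linarith
    qed
    then have "real s * (c + 2) \<le> real s * g"
      using s1 by (simp add: g algebra_simps)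
    then have gbig: "c + 2 \<le> g" using s1 by simp
    have sg: "real s * g = real s * P + Q - real s * l"
      using s1 by (simp add: g algebra_simps)
    have "0 \<le> (real s - 1) * (P + p)" "0 \<le> P + p"
      using P s1 lnM by (auto intro!: mult_nonneg_nonneg)
    then have "P + p \<le> real s * P + real s * p" "0 \<le> P + p"
      by (auto simp: algebra_simps)
    moreover have "p \<le> real s * p" "q \<le> real s * q" "0 \<le> real s * l" "0 \<le> real s * ln 4" "0 \<le> real s * g"
      using s1 nonneg gbig c0 mult_right_mono[of 1 "real s" p] mult_right_mono[of 1 "real s" q] by auto
    moreover have "c = 4 * (real s * p) + 4 * (real s * q) + 4 * (real s * l) + 4 * (real s * ln 4) + 4 * real s"
      by (simp add: c_def algebra_simps)
    moreover have "(2 * real s + 1) * P = 2 * (real s * P) + P"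
      by (simp add: algebra_simps)
    \<comment> \<open>For the upper bound, \<open>P \<le> s * P + s * p\<close> and
      \<open>Q \<le> 3 * Q + 2 * q\<close> turn the sum into \<open>3 * (s * P + Q)\<close> plus
      terms that \<open>c\<close> dominates.\<close>
    ultimately have "\<bar>real s * ln 4 + (2 * real s + 1) * P + Q\<bar> \<le> 3 * (real s * g) + c"
      using Q sg s1 nonneg by linarith
    then have "real (squarings s M \<epsilon>) \<le> 3 * (real s * g) + c + 2"
      using squarings_le[OF assms(1) M1 \<epsilon>(1), folded P_def Q_def] by linarith
    with gbig c0 show ?thesis
      unfolding Q_def[symmetric] g_def[symmetric] by (simp add: algebra_simps)
  qed
  then show ?thesis
    by (intro bigoI[of _ "3 * real s + 1"] eventually_growthI[of T]) auto
qed

theorem theorem4: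
  fixes s :: nat
  assumes "s \<in> {1..33}"
  shows "(\<forall>M>1. \<forall>N\<ge>1. soc_representable (K_sc M N (2 * s))) \<and>
    (\<exists>N :: real \<Rightarrow> real \<Rightarrow> nat.
       (\<forall>M>1. \<forall>\<epsilon>\<in>{0<..<2 * M\<^sup>2 * ln M}.
          N M \<epsilon> \<ge> 1 \<and>
          K_exp M (-\<epsilon>) \<inter> x3_slab M \<subseteq> K_sc M (N M \<epsilon>) (2 * s) \<inter> x3_slab M \<and>
          K_sc M (N M \<epsilon>) (2 * s) \<inter> x3_slab M \<subseteq> K_exp M \<epsilon> \<inter> x3_slab M) \<and>
       (\<forall>m>1. \<forall>e>0.
          (\<lambda>(M, \<epsilon>). real (N M \<epsilon>)) \<in>
            O[growth m e](\<lambda>(M, \<epsilon>). ln (M\<^sup>2 * ln M / real s) + ln (1 / \<epsilon>) / real s))) \<and>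
    (\<forall>M>1. \<forall>N\<ge>1. K_sc M N 2 =
       {(x1, x2, x3) \<in> cone_dom M. \<exists>r :: nat \<Rightarrow> real.
          (\<forall>k\<in>{1..N-1}. r k \<ge> 0) \<and>
          [2 * r 1, x1 - x2, x1 + x2] \<in> lorentz_cone 3 \<and>
          (\<forall>k\<in>{1..N-1}. [2 * r (k + 1), r k - x2, r k + x2] \<in> lorentz_cone 3) \<and>
          [x2 + x3 / 2 ^ N, r N - x2, r N] \<in> lorentz_cone 3})"
proof -
  have s: "1 \<le> s" "s \<le> 33" using assms by auto
  show ?thesis
  proof (intro conjI exI[of _ "squarings s"] allI impI ballI)
    fix M \<epsilon> :: real
    assume M: "1 < M" and "\<epsilon> \<in> {0<..<2 * M\<^sup>2 * ln M}"
    then have \<epsilon>: "0 < \<epsilon>" "\<epsilon> < 2 * M\<^sup>2 * ln M" by auto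
    show "1 \<le> squarings s M \<epsilon>" by (simp add: squarings_def)
    note between = K_sc_between_K_exp[OF s(1) M \<epsilon> refl squarings_sufficient[OF s(1) M \<epsilon>(1)]]
    show "K_exp M (-\<epsilon>) \<inter> x3_slab M \<subseteq> K_sc M (squarings s M \<epsilon>) (2 * s) \<inter> x3_slab M"
      by (rule between(1))
    show "K_sc M (squarings s M \<epsilon>) (2 * s) \<inter> x3_slab M \<subseteq> K_exp M \<epsilon> \<inter> x3_slab M"
      by (rule between(2))
  qed (intro soc_representable_K_sc squarings_bigo K_sc_2_eq s; assumption)+
qed

end
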